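(* Let $\delta$ be a positive rational number, let $(X_t)_{t\in\mathbb N}$ be a sequence of i.i.d. $\mathbb N$-valued random variables, and let $(G_t)_{t\ge0}$ be the growing undirected graph generated by the preferential attachment model with random initial degrees with parameters $\delta,(X_t)$ (defined in the context). Suppose $\ell=\ell(n)$ and $u=u(n)$ are positive integers such that $\mathbb P[X_1\notin[\ell,u]]=o(1/n)$ as $n\to\infty$. Then there is a constant $C$, not depending on $n$, such that asymptotically almost surely (as $n\to\infty$) the diameter of $G_n$ is at most $$4e\left(\frac{u}{\ell}+\frac{\delta}{2\ell}\right)\log n+C\,u.$$
   Context: Conventions: $\mathbb N=\{1,2,\dots\}$; $\log$ is the natural logarithm and $e$ its base. Graphs are finite and may have loops and parallel edges. The diameter is the maximum distance between two vertices. The initial graph $G_0$ is finite of size $O(1)$ (bounded independently of $n$). "Asymptotically almost surely" means with probability tending to $1$ as $n\to\infty$. Random choices at time $t$ have the stated distributions conditionally on the history of the process up to time $t-1$ and on the value $X_t$. For an undirected graph $G$ and a real number $\delta$, $\rho_\delta(v)=(\deg(v)+\delta)/\sum_{u\in V(G)}(\deg(u)+\delta)$ for $v\in V(G)$, where a loop is counted twice in the degree; for $\delta>-1$ this is a probability distribution on $V(G)$. Preferential attachment with random initial degrees (PARID): $G_0$ is an arbitrary connected graph with at least one edge. At each time-step $t\in\mathbb N$, $G_t$ is obtained from $G_{t-1}$ by sampling $X_t$ vertices $N_1,\dots,N_{X_t}$ of $G_{t-1}$ independently using $\rho_\delta$ and adding one new vertex $v$ and $X_t$ new edges $vN_1,\dots,vN_{X_t}$.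 *)

theory Defs
  imports "HOL-Probability.Probability" "HOL-Library.Uprod" "HOL-Library.Landau_Symbols"
begin

text \<open>
  Finite undirected multigraphs. Edges form a multiset of unordered pairs, so parallel edges
  have multiplicity greater than one, and a loop at \<open>x\<close> is \<open>Upair x x\<close>.
\<close>

record 'v mgraph =
  verts :: "'v set"
  edges :: "'v uprod multiset"

definition wf_mgraph :: "'v mgraph \<Rightarrow> bool" where
  "wf_mgraph G \<longleftrightarrow> finite (verts G) \<and> (\<forall>e \<in># edges G. set_uprod e \<subseteq> verts G)"

text \<open>A loop is counted by both summands, hence twice.\<close>

definition deg :: "'v mgraph \<Rightarrow> 'v \<Rightarrow> nat" where
  "deg G x = size {#e \<in># edges G. x \<in> set_uprod e#} + count (edges G) (Upair x x)"

definition adj :: "'v mgraph \<Rightarrow> 'v rel" where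
  "adj G = {(x, y). Upair x y \<in># edges G}"

definition connected_mgraph :: "'v mgraph \<Rightarrow> bool" where
  "connected_mgraph G \<longleftrightarrow> verts G \<noteq> {} \<and> (\<forall>x \<in> verts G. \<forall>y \<in> verts G. (x, y) \<in> (adj G)\<^sup>*)"

text \<open>The distance is the least length of a walk, and \<open>\<infinity>\<close> if there is no walk.\<close>

definition graph_dist :: "'v mgraph \<Rightarrow> 'v \<Rightarrow> 'v \<Rightarrow> enat" where
  "graph_dist G x y = (INF k \<in> {k. (x, y) \<in> adj G ^^ k}. enat k)"

definition graph_diameter :: "'v mgraph \<Rightarrow> enat" where
  "graph_diameter G = (SUP x \<in> verts G. SUP y \<in> verts G. graph_dist G x y)"

definition rho :: "real \<Rightarrow> 'v mgraph \<Rightarrow> 'v \<Rightarrow> real" where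
  "rho \<delta> G x = (real (deg G x) + \<delta>) / (\<Sum>y \<in> verts G. real (deg G y) + \<delta>)"

definition attach :: "'v mgraph \<Rightarrow> 'v \<Rightarrow> 'v list \<Rightarrow> 'v mgraph" where
  "attach G w ns = \<lparr>verts = insert w (verts G), edges = edges G + mset (map (Upair w) ns)\<rparr>"

text \<open>
  Preferential attachment with random initial degrees, started from the deterministic graph
  \<open>G0\<close>. The vertex added at time \<open>t \<ge> 1\<close> has the fixed, fresh name \<open>new t\<close>, and \<open>N t\<close> is the
  list of the \<open>X t\<close> vertices sampled at time \<open>t\<close>; only indices \<open>t \<ge> 1\<close> of \<open>X\<close>, \<open>N\<close> and \<open>new\<close>
  matter. All spaces of values are discrete, so \<open>cond_law\<close> says that, given the
  whole history up to time \<open>t\<close> and the value of \<open>X (t + 1)\<close>, the entries of \<open>N (t + 1)\<close> are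
  independent with law \<open>rho \<delta> (G t)\<close>. (The history determines \<open>X s = length (N s)\<close> for
  \<open>s \<le> t\<close>.) The joint law of the \<open>X t\<close> is left open here.
\<close>

locale parid = prob_space M
  for M :: "'a measure" +
  fixes \<delta> :: real
    and G0 :: "'v mgraph"
    and new :: "nat \<Rightarrow> 'v"
    and X :: "nat \<Rightarrow> 'a \<Rightarrow> nat"
    and N :: "nat \<Rightarrow> 'a \<Rightarrow> 'v list"
    and G :: "nat \<Rightarrow> 'a \<Rightarrow> 'v mgraph"
  assumes G0_wf: "wf_mgraph G0"
    and G0_connected: "connected_mgraph G0"
    and G0_edge: "edges G0 \<noteq> {#}"
    and new_inj: "inj_on new {1..}"
    and new_fresh: "\<And>t. t \<ge> 1 \<Longrightarrow> new t \<notin> verts G0"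
    and N_measurable: "\<And>t. t \<ge> 1 \<Longrightarrow> N t \<in> M \<rightarrow>\<^sub>M count_space UNIV"
    and N_length: "\<And>t \<omega>. t \<ge> 1 \<Longrightarrow> \<omega> \<in> space M \<Longrightarrow> length (N t \<omega>) = X t \<omega>"
    and N_verts: "\<And>t \<omega>. \<omega> \<in> space M \<Longrightarrow> set (N (Suc t) \<omega>) \<subseteq> verts (G t \<omega>)"
    and G_0: "\<And>\<omega>. \<omega> \<in> space M \<Longrightarrow> G 0 \<omega> = G0"
    and G_Suc: "\<And>t \<omega>. \<omega> \<in> space M \<Longrightarrow> G (Suc t) \<omega> = attach (G t \<omega>) (new (Suc t)) (N (Suc t) \<omega>)"
    and cond_law: "\<And>t g h x ns. length ns = x \<Longrightarrow> set ns \<subseteq> verts (g t) \<Longrightarrow>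
      prob {\<omega> \<in> space M. (\<forall>s \<in> {0..t}. G s \<omega> = g s) \<and> (\<forall>s \<in> {1..t}. N s \<omega> = h s) \<and>
              X (Suc t) \<omega> = x \<and> N (Suc t) \<omega> = ns}
      = prob {\<omega> \<in> space M. (\<forall>s \<in> {0..t}. G s \<omega> = g s) \<and> (\<forall>s \<in> {1..t}. N s \<omega> = h s) \<and>
              X (Suc t) \<omega> = x}
        * (\<Prod>i<x. rho \<delta> (g t) (ns ! i))"

end

theory Submission imports Defs begin

text \<open>
  Let the parent of a new vertex be its first sampled neighbour, and let the depth of a vertex be
  the number of parent steps needed to reach \<open>G0\<close>; the diameter exceeds twice the
  maximal depth by at most a constant. Weigh a vertex \<open>v\<close> by \<open>(deg v + \<delta>) * z ^ depth v\<close>. Given the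
  past, a step with \<open>x\<close> new edges multiplies the expected total weight by exactly
  \<open>1 + (x + (x + \<delta>) * z) / S\<close>, where \<open>S\<close> is the sum of all \<open>deg v + \<delta>\<close>. As long as all initial degrees
  lie in \<open>{l..u}\<close>, \<open>S\<close> grows at least like \<open>t * (2 * l + \<delta>)\<close>, so that the expected weight at
  time \<open>n\<close> is at most \<open>n powr ((u + (u + \<delta>) * z) / (2 * l + \<delta>)) * exp (O(u))\<close>. Markov's
  inequality with \<open>z = exp 1\<close> bounds the maximal depth, with room to spare.
\<close>

section \<open>Degrees and distances\<close>

lemma deg_attach_new:
  assumes "wf_mgraph G" "w \<notin> verts G" "set ns \<subseteq> verts G"
  shows "deg (attach G w ns) w = length ns"
proof -
  have 1: "filter_mset (\<lambda>e. w \<in> set_uprod e) (edges G) = {#}"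
    using assms by (auto simp: wf_mgraph_def filter_mset_eq_conv)
  have 2: "count (edges G) (Upair w w) = 0"
    using assms by (force simp: wf_mgraph_def count_eq_zero_iff)
  have 3: "count (mset (map (Upair w) ns)) (Upair w w) = 0"
    using assms by (auto simp: count_eq_zero_iff)
  have 4: "filter_mset (\<lambda>e. w \<in> set_uprod e) (mset (map (Upair w) ns)) = mset (map (Upair w) ns)"
    by (auto simp: filter_mset_eq_conv)
  show ?thesis
    using 1 2 3 4 by (simp add: deg_def attach_def del: mset_map)
qed

lemma deg_attach_old:
  assumes "v \<noteq> w"
  shows "deg (attach G w ns) v = deg G v + count (mset ns) v"
proof -
  have 1: "count (mset (map (Upair w) ns)) (Upair v v) = 0"
    using assms by (auto simp: count_eq_zero_iff)
  have 2: "size (filter_mset (\<lambda>e. v \<in> set_uprod e) (mset (map (Upair w) ns))) = count (mset ns) v"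
    using assms by (induction ns) auto
  show ?thesis
    using 1 2 by (simp add: deg_def attach_def del: mset_map)
qed

lemma wf_mgraph_attach:
  "wf_mgraph G \<Longrightarrow> set ns \<subseteq> verts G \<Longrightarrow> wf_mgraph (attach G w ns)"
  by (auto simp: wf_mgraph_def attach_def)

lemma adj_attach_mono: "adj G \<subseteq> adj (attach G w ns)"
  by (auto simp: adj_def attach_def)

lemma adj_attach_new: "v \<in> set ns \<Longrightarrow> (w, v) \<in> adj (attach G w ns)"
  by (auto simp: adj_def attach_def)

lemma sym_adj: "sym (adj G)"
  by (auto simp: adj_def sym_def) (metis Upair_inject)

lemma sym_adj_relpow: "(x, y) \<in> adj G ^^ k \<Longrightarrow> (y, x) \<in> adj G ^^ k"
proof (induction k arbitrary: y)
  case (Suc k)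
  then obtain w where "(x, w) \<in> adj G ^^ k" "(w, y) \<in> adj G" by auto
  then show ?case using Suc.IH sym_adj by (metis relpow_Suc_I2 symD)
qed auto

lemma relpow_subset_mono:
  fixes R S :: "'a rel"
  shows "R \<subseteq> S \<Longrightarrow> (x, y) \<in> R ^^ k \<Longrightarrow> (x, y) \<in> S ^^ k"
  by (induction k arbitrary: y) auto

text \<open>There are only finitely many pairs of vertices, so the chosen walk lengths have a
  maximum. Walks are recorded because they persist when the graph grows.\<close>

lemma connected_bounded_walks:
  assumes "wf_mgraph G" "connected_mgraph G"
  obtains D where "\<And>x y. x \<in> verts G \<Longrightarrow> y \<in> verts G \<Longrightarrow> \<exists>k\<le>D. (x, y) \<in> adj G ^^ k"
proof -
  have fin: "finite (verts G \<times> verts G)" using assms(1) by (auto simp: wf_mgraph_def)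
  have "\<forall>p\<in>verts G \<times> verts G. \<exists>k. p \<in> adj G ^^ k"
    using assms(2) by (force simp: connected_mgraph_def dest: rtrancl_imp_relpow)
  then obtain k where k: "\<And>p. p \<in> verts G \<times> verts G \<Longrightarrow> p \<in> adj G ^^ k p" by metis
  show ?thesis
  proof (rule that)
    fix x y assume "x \<in> verts G" "y \<in> verts G"
    with k[of "(x, y)"] fin
    show "\<exists>j \<le> Max (k ` (verts G \<times> verts G)). (x, y) \<in> adj G ^^ j"
      by (intro exI[of _ "k (x, y)"]) auto
  qed
qed

section \<open>Graphs built from histories\<close>

text \<open>A history lists the sampled vertex lists, the most recent one first.\<close>

primrec build :: "'v mgraph \<Rightarrow> (nat \<Rightarrow> 'v) \<Rightarrow> 'v list list \<Rightarrow> 'v mgraph" where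
  "build G0 new [] = G0"
| "build G0 new (ns # hs) = attach (build G0 new hs) (new (Suc (length hs))) ns"

text \<open>The parent of a new vertex is \<open>hd ns\<close>, which is meaningful only for
  nonempty \<open>ns\<close>; \<open>depth_walk\<close> and \<open>sum_depth_weight_Cons\<close>
  therefore exclude initial degree 0. A vertex that the history did not add has the default depth
  0.\<close>

primrec depth :: "(nat \<Rightarrow> 'v) \<Rightarrow> 'v list list \<Rightarrow> 'v \<Rightarrow> nat" where
  "depth new [] v = 0"
| "depth new (ns # hs) v =
    (if v = new (Suc (length hs)) then Suc (depth new hs (hd ns)) else depth new hs v)"

text \<open>\<open>A\<close> is the set of admissible initial degrees. In the process a finite
  \<open>A\<close> leaves finitely many histories, so expectations on the event that all degrees lie
  in \<open>A\<close> are finite sums.\<close>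

primrec hists :: "'v mgraph \<Rightarrow> (nat \<Rightarrow> 'v) \<Rightarrow> nat set \<Rightarrow> nat \<Rightarrow> 'v list list set" where
  "hists G0 new A 0 = {[]}"
| "hists G0 new A (Suc t) =
    (\<lambda>(hs, ns). ns # hs) `
      (SIGMA hs : hists G0 new A t. {ns. set ns \<subseteq> verts (build G0 new hs) \<and> length ns \<in> A})"

definition total_weight :: "real \<Rightarrow> 'v mgraph \<Rightarrow> real" where
  "total_weight \<delta> G = (\<Sum>v\<in>verts G. real (deg G v) + \<delta>)"

text \<open>Divided by the total weight of the same graph, this is the generating function in
  \<open>z\<close> of the depth of a vertex drawn from \<open>rho\<close>.\<close>

definition depth_weight :: "real \<Rightarrow> real \<Rightarrow> 'v mgraph \<Rightarrow> (nat \<Rightarrow> 'v) \<Rightarrow> 'v list list \<Rightarrow> real" where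
  "depth_weight \<delta> z G0 new hs =
    (\<Sum>v\<in>verts (build G0 new hs). (real (deg (build G0 new hs) v) + \<delta>) * z ^ depth new hs v)"

lemma sum_count_mset:
  fixes f :: "'v \<Rightarrow> real"
  assumes "finite V" "set ns \<subseteq> V"
  shows "(\<Sum>v\<in>V. real (count (mset ns) v) * f v) = sum_list (map f ns)"
  using assms(2)
proof (induction ns)
  case (Cons a ns)
  have "(\<Sum>v\<in>V. real (count (mset (a # ns)) v) * f v)
      = (\<Sum>v\<in>V. real (count (mset ns) v) * f v + (if v = a then f v else 0))"
    by (intro sum.cong) (auto simp: algebra_simps)
  also have "\<dots> = sum_list (map f ns) + f a"
    using Cons assms(1) by (simp add: sum.distrib)
  finally show ?case by simp
qed simp

text \<open>One step raises the degree of an old vertex once per occurrence in \<open>ns\<close> and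
  adds \<open>w\<close> with degree \<open>length ns\<close>. Constant \<open>f\<close> and
  \<open>g\<close> give the growth of the total weight, powers of \<open>z\<close> that of the depth
  weight.\<close>

lemma sum_attach:
  fixes f g :: "'v \<Rightarrow> real"
  assumes "wf_mgraph G" "w \<notin> verts G" "set ns \<subseteq> verts G"
    and "\<And>v. v \<in> verts G \<Longrightarrow> g v = f v"
  shows "(\<Sum>v\<in>verts (attach G w ns). (real (deg (attach G w ns) v) + \<delta>) * g v)
    = (\<Sum>v\<in>verts G. (real (deg G v) + \<delta>) * f v) + sum_list (map f ns)
      + (real (length ns) + \<delta>) * g w"
proof -
  have fin: "finite (verts G)" using assms(1) by (simp add: wf_mgraph_def)
  have "(\<Sum>v\<in>verts (attach G w ns). (real (deg (attach G w ns) v) + \<delta>) * g v)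
    = (real (length ns) + \<delta>) * g w + (\<Sum>v\<in>verts G. (real (deg (attach G w ns) v) + \<delta>) * g v)"
    using fin assms(2) deg_attach_new[OF assms(1-3)] by (simp add: attach_def)
  also have "(\<Sum>v\<in>verts G. (real (deg (attach G w ns) v) + \<delta>) * g v)
    = (\<Sum>v\<in>verts G. (real (deg G v) + \<delta>) * f v + real (count (mset ns) v) * f v)"
    using assms(2,4) by (intro sum.cong refl) (subst deg_attach_old, auto simp: algebra_simps)
  also have "\<dots> = (\<Sum>v\<in>verts G. (real (deg G v) + \<delta>) * f v) + sum_list (map f ns)"
    using sum_count_mset[OF fin assms(3)] by (simp add: sum.distrib)
  finally show ?thesis by simp
qed

section \<open>Sums over lists of independent samples\<close>

lemma sum_lists_Suc:
  fixes F :: "'v list \<Rightarrow> real"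
  assumes "finite V"
  shows "(\<Sum>ns | set ns \<subseteq> V \<and> length ns = Suc x. F ns)
    = (\<Sum>v\<in>V. \<Sum>ns | set ns \<subseteq> V \<and> length ns = x. F (v # ns))"
proof -
  have "{ns. set ns \<subseteq> V \<and> length ns = Suc x}
      = (\<lambda>(v, ns). v # ns) ` (V \<times> {ns. set ns \<subseteq> V \<and> length ns = x})"
    by (auto simp: length_Suc_conv image_iff)
  then show ?thesis
    by (simp add: sum.cartesian_product sum.reindex inj_on_def case_prod_beta)
qed

context
  fixes V :: "'v set" and p f :: "'v \<Rightarrow> real"
  assumes fin: "finite V" and p1: "(\<Sum>v\<in>V. p v) = 1"
begin

text \<open>\<open>prod_list (map p ns)\<close> is the joint law of \<open>x\<close> independent
  samples from \<open>p\<close>; its total mass is a power of that of \<open>p\<close>.\<close>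

lemma sum_lists_prod: "(\<Sum>ns | set ns \<subseteq> V \<and> length ns = x. prod_list (map p ns)) = 1"
proof (induction x)
  case 0
  have "{ns. set ns \<subseteq> V \<and> length ns = 0} = {[]}" by auto
  then show ?case by simp
next
  case (Suc x)
  then show ?case by (simp add: sum_lists_Suc[OF fin] p1 flip: sum_distrib_left)
qed

text \<open>The first sample has law \<open>p\<close>, and the remaining ones integrate out to
  1.\<close>

lemma sum_lists_prod_hd:
  assumes "x > 0"
  shows "(\<Sum>ns | set ns \<subseteq> V \<and> length ns = x. prod_list (map p ns) * f (hd ns))
    = (\<Sum>v\<in>V. p v * f v)"
proof -
  obtain y where "x = Suc y" using assms gr0_implies_Suc by blast
  then have "(\<Sum>ns | set ns \<subseteq> V \<and> length ns = x. prod_list (map p ns) * f (hd ns))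
      = (\<Sum>v\<in>V. p v * f v * (\<Sum>ns | set ns \<subseteq> V \<and> length ns = y. prod_list (map p ns)))"
    by (simp add: sum_lists_Suc[OF fin] sum_distrib_left mult_ac)
  then show ?thesis by (simp add: sum_lists_prod)
qed

text \<open>Linearity of expectation: each of the \<open>x\<close> samples contributes the mean of
  \<open>f\<close> under \<open>p\<close>.\<close>

lemma sum_lists_prod_sum_list:
  "(\<Sum>ns | set ns \<subseteq> V \<and> length ns = x. prod_list (map p ns) * sum_list (map f ns))
    = real x * (\<Sum>v\<in>V. p v * f v)"
proof (induction x)
  case 0
  have "{ns. set ns \<subseteq> V \<and> length ns = 0} = {[]}" by auto
  then show ?case by simp
next
  case (Suc x)
  let ?L = "{ns. set ns \<subseteq> V \<and> length ns = x}"
  have "(\<Sum>ns | set ns \<subseteq> V \<and> length ns = Suc x. prod_list (map p ns) * sum_list (map f ns))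
    = (\<Sum>v\<in>V. \<Sum>ns\<in>?L. p v * f v * prod_list (map p ns)
        + p v * (prod_list (map p ns) * sum_list (map f ns)))"
    by (simp add: sum_lists_Suc[OF fin] algebra_simps)
  also have "\<dots> = (\<Sum>v\<in>V. p v * f v + p v * (real x * (\<Sum>v\<in>V. p v * f v)))"
    by (simp add: sum.distrib Suc sum_lists_prod flip: sum_distrib_left)
  also have "\<dots> = real (Suc x) * (\<Sum>v\<in>V. p v * f v)"
    by (simp only: sum.distrib p1 flip: sum_distrib_right) (simp add: algebra_simps)
  finally show ?case .
qed

end

section \<open>The process\<close>

context parid
begin

abbreviation gr :: "'v list list \<Rightarrow> 'v mgraph" where
  "gr \<equiv> build G0 new"

primrec hist :: "nat \<Rightarrow> 'a \<Rightarrow> 'v list list" where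
  "hist 0 \<omega> = []"
| "hist (Suc t) \<omega> = N (Suc t) \<omega> # hist t \<omega>"

text \<open>For each fixed length these events are disjoint and cover the space; they are the atoms
  over which expectations are summed.\<close>

definition hist_event :: "'v list list \<Rightarrow> 'a set" where
  "hist_event hs = {\<omega> \<in> space M. hist (length hs) \<omega> = hs}"

lemma length_hist [simp]: "length (hist t \<omega>) = t"
  by (induction t) auto

lemma verts_gr: "verts (gr hs) = verts G0 \<union> new ` {1..length hs}"
  by (induction hs) (auto simp: attach_def atLeastAtMostSuc_conv)

lemma finite_verts_gr: "finite (verts (gr hs))"
  using G0_wf by (auto simp: verts_gr wf_mgraph_def)

lemma fresh_gr: "new (Suc (length hs)) \<notin> verts (gr hs)"
proof -
  have "new (Suc (length hs)) \<noteq> new s" if "s \<in> {1..length hs}" for s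
    using inj_onD[OF new_inj, of "Suc (length hs)" s] that by auto
  then show ?thesis using new_fresh[of "Suc (length hs)"] by (simp add: verts_gr image_iff)
qed

lemma G_eq_gr: "\<omega> \<in> space M \<Longrightarrow> G t \<omega> = gr (hist t \<omega>)"
  by (induction t) (auto simp: G_0 G_Suc)

lemma hists_props:
  assumes "hs \<in> hists G0 new A t"
  shows "length hs = t" "wf_mgraph (gr hs)"
proof -
  have "length hs = t \<and> wf_mgraph (gr hs)"
    using assms by (induction t arbitrary: hs) (fastforce simp: G0_wf intro: wf_mgraph_attach)+
  then show "length hs = t" "wf_mgraph (gr hs)" by auto
qed

lemma finite_lists_in:
  assumes "finite V" "finite A"
  shows "finite {ns. set ns \<subseteq> V \<and> length ns \<in> A}"
proof -
  have "{ns. set ns \<subseteq> V \<and> length ns \<in> A} = (\<Union>x\<in>A. {ns. set ns \<subseteq> V \<and> length ns = x})" by auto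
  then show ?thesis using assms by (auto intro: finite_lists_length_eq)
qed

lemma finite_hists: "finite A \<Longrightarrow> finite (hists G0 new A t)"
  by (induction t) (auto simp: finite_verts_gr intro!: finite_imageI finite_SigmaI finite_lists_in)

lemma hist_in_hists:
  assumes "\<omega> \<in> space M" "\<And>s. 1 \<le> s \<Longrightarrow> s \<le> t \<Longrightarrow> X s \<omega> \<in> A"
  shows "hist t \<omega> \<in> hists G0 new A t"
  using assms(2)
proof (induction t)
  case (Suc t)
  have "set (N (Suc t) \<omega>) \<subseteq> verts (gr (hist t \<omega>))"
    using N_verts[of \<omega> t] G_eq_gr assms(1) by metis
  moreover have "length (N (Suc t) \<omega>) \<in> A"
    using Suc.prems N_length assms(1) by auto
  moreover have "hist t \<omega> \<in> hists G0 new A t" using Suc by auto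
  ultimately show ?case by (auto simp: image_iff)
qed simp

section \<open>Measurability and the law of a history\<close>

lemma N_eq_measurable [measurable]: "t \<ge> 1 \<Longrightarrow> {\<omega> \<in> space M. N t \<omega> = ns} \<in> events"
  using measurable_sets[OF N_measurable, of t "{ns}"] by (simp add: vimage_def Int_def conj_commute)

lemma X_measurable: "t \<ge> 1 \<Longrightarrow> {\<omega> \<in> space M. X t \<omega> \<in> B} \<in> events"
proof -
  assume t: "t \<ge> 1"
  have "{\<omega> \<in> space M. X t \<omega> \<in> B} = N t -` {ns. length ns \<in> B} \<inter> space M"
    using N_length[OF t] by auto
  then show ?thesis using measurable_sets[OF N_measurable[OF t], of "{ns. length ns \<in> B}"] by simp
qed

lemma hist_event_measurable: "hist_event hs \<in> events"
proof (induction hs)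
  case (Cons ns hs)
  have "hist_event (ns # hs) = hist_event hs \<inter> {\<omega> \<in> space M. N (Suc (length hs)) \<omega> = ns}"
    by (auto simp: hist_event_def)
  with Cons show ?case using N_eq_measurable[of "Suc (length hs)" ns] by (auto intro: sets.Int)
qed (simp add: hist_event_def)

text \<open>A union over countably many histories, although the vertex type may be uncountable.\<close>
lemma hist_pred_measurable: "{\<omega> \<in> space M. P (hist n \<omega>)} \<in> events"
proof -
  \<comment> \<open>Every vertex that can occur up to time \<open>n\<close> lies in this fixed
    finite set, so only countably many histories arise even though the degrees are
    unbounded.\<close>
  let ?V = "verts G0 \<union> new ` {1..n}"
  have "countable (lists (lists ?V))"
    using G0_wf by (intro countable_lists countable_finite) (auto simp: wf_mgraph_def)
  have sub: "hist t \<omega> \<in> lists (lists ?V)" if "\<omega> \<in> space M" "t \<le> n" for t \<omega>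
    using that(2)
  proof (induction t)
    case (Suc t)
    have "set (N (Suc t) \<omega>) \<subseteq> verts (gr (hist t \<omega>))"
      using N_verts[of \<omega> t] G_eq_gr that by metis
    with Suc show ?case by (auto simp: verts_gr in_lists_conv_set)
  qed simp
  have "{\<omega> \<in> space M. P (hist n \<omega>)}
      = (\<Union>hs\<in>{hs\<in>lists (lists ?V). length hs = n \<and> P hs}. hist_event hs)"
    using sub by (fastforce simp: hist_event_def)
  also have "\<dots> \<in> events"
    using \<open>countable _\<close> hist_event_measurable
    by (intro sets.countable_UN') (auto intro: countable_subset)
  finally show ?thesis .
qed

text \<open>This is \<open>cond_law\<close> in terms of histories: a history fixes all earlier
  samples and graphs, so \<open>hist_event hs\<close> is the conditioning event.\<close>

lemma prob_hist_event_Cons: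
  assumes "set ns \<subseteq> verts (gr hs)"
  shows "prob (hist_event (ns # hs))
    = prob (hist_event hs \<inter> {\<omega> \<in> space M. X (Suc (length hs)) \<omega> = length ns})
      * prod_list (map (rho \<delta> (gr hs)) ns)"
\<comment> \<open>On an empty event both sides vanish; otherwise a sample point
  \<open>\<omega>0\<close> supplies the values of the graphs and samples that
  \<open>cond_law\<close> asks for.\<close>
proof (cases "hist_event hs = {}")
  case True
  then have "hist_event (ns # hs) = {}" by (auto simp: hist_event_def)
  with True show ?thesis by simp
next
  case False
  let ?t = "length hs"
  obtain \<omega>0 where \<omega>0: "\<omega>0 \<in> space M" "hist ?t \<omega>0 = hs"
    using False by (auto simp: hist_event_def)
  have iff: "hist t \<omega> = hist t \<omega>0 \<longleftrightarrow> (\<forall>s\<in>{1..t}. N s \<omega> = N s \<omega>0)" for t \<omega>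
    by (induction t) (auto simp: atLeastAtMostSuc_conv)
  \<comment> \<open>Graphs are functions of the history, so fixing the samples also fixes
    \<open>G s\<close> for all \<open>s \<le> ?t\<close>.\<close>
  have hist_eq: "hist ?t \<omega> = hs \<longleftrightarrow>
      (\<forall>s\<in>{0..?t}. G s \<omega> = G s \<omega>0) \<and> (\<forall>s\<in>{1..?t}. N s \<omega> = N s \<omega>0)"
    if "\<omega> \<in> space M" for \<omega>
  proof -
    have "G s \<omega> = G s \<omega>0" if "\<forall>s\<in>{1..?t}. N s \<omega> = N s \<omega>0" "s \<le> ?t" for s
      using iff[of s \<omega>] that G_eq_gr \<omega>0(1) \<open>\<omega> \<in> space M\<close> by auto
    then show ?thesis using iff[of ?t \<omega>] \<omega>0(2) by auto
  qed
  have gr0: "G ?t \<omega>0 = gr hs" using \<omega>0 G_eq_gr by metis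
  have e1: "hist_event (ns # hs) = {\<omega> \<in> space M. (\<forall>s \<in> {0..?t}. G s \<omega> = G s \<omega>0) \<and>
      (\<forall>s \<in> {1..?t}. N s \<omega> = N s \<omega>0) \<and> X (Suc ?t) \<omega> = length ns \<and> N (Suc ?t) \<omega> = ns}"
    using hist_eq N_length[of "Suc ?t"] by (auto simp: hist_event_def)
  have e2: "hist_event hs \<inter> {\<omega> \<in> space M. X (Suc ?t) \<omega> = length ns}
      = {\<omega> \<in> space M. (\<forall>s \<in> {0..?t}. G s \<omega> = G s \<omega>0) \<and>
      (\<forall>s \<in> {1..?t}. N s \<omega> = N s \<omega>0) \<and> X (Suc ?t) \<omega> = length ns}"
    using hist_eq by (auto simp: hist_event_def)
  have e3: "prod_list (map (rho \<delta> (gr hs)) ns) = (\<Prod>i<length ns. rho \<delta> (gr hs) (ns ! i))"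
    by (simp add: prod.list_conv_set_nth lessThan_atLeast0)
  show ?thesis
    unfolding e1 e2 e3
    using cond_law[of ns "length ns" "\<lambda>s. G s \<omega>0" ?t "\<lambda>s. N s \<omega>0"] assms by (simp add: gr0)
qed

section \<open>Depth and diameter\<close>

text \<open>Follow parents down to \<open>G0\<close>. As \<open>0 \<notin> A\<close>, every new
  vertex has a parent, and walks of earlier graphs survive later attachments.\<close>

lemma depth_walk:
  assumes "hs \<in> hists G0 new A t" "0 \<notin> A" "v \<in> verts (gr hs)"
  shows "\<exists>r\<in>verts G0. (v, r) \<in> adj (gr hs) ^^ depth new hs v"
  using assms(1,3)
proof (induction t arbitrary: hs v)
  case 0
  then show ?case by auto
next
  case (Suc t)
  then obtain ns hs' where hs: "hs = ns # hs'" "hs' \<in> hists G0 new A t"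
    "set ns \<subseteq> verts (gr hs')" "length ns \<in> A" by auto
  let ?w = "new (Suc (length hs'))"
  have step: "\<exists>r\<in>verts G0. (v, r) \<in> adj (gr hs) ^^ depth new hs' v" if "v \<in> verts (gr hs')" for v
    using Suc.IH[OF hs(2) that] relpow_subset_mono[OF adj_attach_mono] by (fastforce simp: hs(1))
  show ?case
  proof (cases "v = ?w")
    case True
    have "ns \<noteq> []" using hs(4) assms(2) by auto
    then have hd: "hd ns \<in> verts (gr hs')" "(v, hd ns) \<in> adj (gr hs)"
      using hs(3) True adj_attach_new[of "hd ns" ns] by (auto simp: hs(1))
    with step obtain r where "r \<in> verts G0" "(hd ns, r) \<in> adj (gr hs) ^^ depth new hs' (hd ns)"
      by blast
    with hd(2) have "(v, r) \<in> adj (gr hs) ^^ depth new hs v"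
      by (metis True depth.simps(2) hs(1) relpow_Suc_I2)
    with \<open>r \<in> verts G0\<close> show ?thesis by blast
  next
    case False
    with Suc.prems have "v \<in> verts (gr hs')" by (auto simp: hs(1) attach_def)
    with step[of v] False show ?thesis by (simp add: hs(1))
  qed
qed

lemma adj_gr_mono: "adj G0 \<subseteq> adj (gr hs)"
  by (induction hs) (use adj_attach_mono in fastforce)+

text \<open>Two vertices are joined by descending from each to \<open>G0\<close> and connecting the
  endpoints by a walk of length at most \<open>D\<close> inside \<open>G0\<close>.\<close>

lemma diameter_le_depth:
  assumes D: "\<And>x y. x \<in> verts G0 \<Longrightarrow> y \<in> verts G0 \<Longrightarrow> \<exists>k\<le>D. (x, y) \<in> adj G0 ^^ k"
    and hs: "hs \<in> hists G0 new A t" "0 \<notin> A"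
    and K: "\<And>v. v \<in> verts (gr hs) \<Longrightarrow> real (depth new hs v) \<le> K"
  shows "ereal_of_enat (graph_diameter (gr hs)) \<le> ereal (2 * K + real D)"
proof -
  \<comment> \<open>Walk lengths are integers, so the real bound can be rounded down;
    \<open>K0\<close> ensures that \<open>nat\<close> does not replace a negative value by
    0.\<close>
  define k where "k = nat \<lfloor>2 * K + real D\<rfloor>"
  have "verts (gr hs) \<noteq> {}"
    using G0_connected by (auto simp: verts_gr connected_mgraph_def)
  then obtain v0 where "v0 \<in> verts (gr hs)" by auto
  then have K0: "0 \<le> K" using K[of v0] by linarith
  have "graph_dist (gr hs) x y \<le> enat k" if x: "x \<in> verts (gr hs)" and y: "y \<in> verts (gr hs)" for x y
  proof -
    obtain r where r: "r \<in> verts G0" "(x, r) \<in> adj (gr hs) ^^ depth new hs x"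
      using depth_walk[OF hs x] by blast
    obtain s where s: "s \<in> verts G0" "(y, s) \<in> adj (gr hs) ^^ depth new hs y"
      using depth_walk[OF hs y] by blast
    obtain j where j: "j \<le> D" "(r, s) \<in> adj (gr hs) ^^ j"
      using D[OF r(1) s(1)] relpow_subset_mono[OF adj_gr_mono] by blast
    have "(x, y) \<in> adj (gr hs) ^^ (depth new hs x + j + depth new hs y)"
      unfolding relpow_add using r(2) j(2) sym_adj_relpow[OF s(2)] by blast
    then have "graph_dist (gr hs) x y \<le> enat (depth new hs x + j + depth new hs y)"
      unfolding graph_dist_def by (intro INF_lower) auto
    also have "depth new hs x + j + depth new hs y \<le> k"
    proof -
      have "real (depth new hs x + j + depth new hs y) \<le> 2 * K + real D"
        using K[OF x] K[OF y] j(1) by simp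
      then show ?thesis unfolding k_def by linarith
    qed
    finally show ?thesis by simp
  qed
  then have "graph_diameter (gr hs) \<le> enat k"
    unfolding graph_diameter_def by (intro SUP_least)
  then have "ereal_of_enat (graph_diameter (gr hs)) \<le> ereal_of_enat (enat k)"
    by (simp only: ereal_of_enat_le_iff)
  also have "\<dots> \<le> ereal (2 * K + real D)"
    using K0 by (simp add: k_def)
  finally show ?thesis .
qed

section \<open>Growth of the expected weight\<close>

text \<open>A step with \<open>x\<close> new edges adds \<open>2 * x\<close> to the sum of degrees,
  and the new vertex adds one more \<open>\<delta>\<close>.\<close>

lemma total_weight_lower:
  assumes "hs \<in> hists G0 new {l..u} t"
  shows "total_weight \<delta> (gr hs) \<ge> total_weight \<delta> G0 + real t * (2 * real l + \<delta>)"
  using assms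
proof (induction t arbitrary: hs)
  case (Suc t)
  then obtain ns hs' where hs: "hs = ns # hs'" "hs' \<in> hists G0 new {l..u} t"
    "set ns \<subseteq> verts (gr hs')" "length ns \<in> {l..u}" by auto
  have "total_weight \<delta> (gr hs) = total_weight \<delta> (gr hs') + 2 * real (length ns) + \<delta>"
    using sum_attach[OF hists_props(2)[OF hs(2)] fresh_gr hs(3), where f = "\<lambda>_. 1" and g = "\<lambda>_. 1" and \<delta> = \<delta>]
    by (simp add: total_weight_def hs(1) sum_list_triv)
  moreover have "real (length ns) \<ge> real l" using hs(4) by simp
  ultimately show ?case using Suc.IH[OF hs(2)] by (simp add: algebra_simps)
qed simp

text \<open>Old depths do not change because the new name is fresh. The middle term is the gain of
  the sampled vertices, the last one the weight of the new vertex, one level below its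
  parent.\<close>

lemma depth_weight_Cons:
  assumes "wf_mgraph (gr hs)" "set ns \<subseteq> verts (gr hs)"
  shows "depth_weight \<delta> z G0 new (ns # hs) = depth_weight \<delta> z G0 new hs
    + sum_list (map (\<lambda>v. z ^ depth new hs v) ns)
    + (real (length ns) + \<delta>) * (z * z ^ depth new hs (hd ns))"
proof -
  have "z ^ depth new (ns # hs) v = z ^ depth new hs v" if "v \<in> verts (gr hs)" for v
    using that fresh_gr[of hs] by auto
  from sum_attach[OF assms(1) fresh_gr assms(2) this, where \<delta> = \<delta>]
  show ?thesis by (simp add: depth_weight_def)
qed

context
  assumes \<delta>_pos: "\<delta> > 0"
begin

lemma total_weight_G0_pos: "total_weight \<delta> G0 > 0"
  unfolding total_weight_def using G0_wf G0_connected \<delta>_pos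
  by (intro sum_pos) (auto simp: wf_mgraph_def connected_mgraph_def add_nonneg_pos)

lemma total_weight_pos: "total_weight \<delta> (gr hs) > 0"
  unfolding total_weight_def using finite_verts_gr G0_connected \<delta>_pos
  by (intro sum_pos) (auto simp: verts_gr connected_mgraph_def add_nonneg_pos)

lemma depth_weight_nonneg: "z \<ge> 0 \<Longrightarrow> depth_weight \<delta> z G0 new hs \<ge> 0"
  using \<delta>_pos by (auto simp: depth_weight_def intro!: sum_nonneg mult_nonneg_nonneg)

text \<open>Conditional expectation given the history and the degree \<open>x\<close>. The mean of
  \<open>z ^ depth\<close> under \<open>rho\<close> is the depth weight over the total weight, since
  \<open>rho\<close> has the same factor \<open>deg + \<delta>\<close> as numerator. Each of the
  \<open>x\<close> samples contributes this mean once, and the parent contributes it once more with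
  factor \<open>(x + \<delta>) * z\<close>.\<close>

lemma sum_depth_weight_Cons:
  assumes "wf_mgraph (gr hs)" "x > 0"
  shows "(\<Sum>ns | set ns \<subseteq> verts (gr hs) \<and> length ns = x.
      prod_list (map (rho \<delta> (gr hs)) ns) * depth_weight \<delta> z G0 new (ns # hs))
    = depth_weight \<delta> z G0 new hs
      * (1 + (real x + (real x + \<delta>) * z) / total_weight \<delta> (gr hs))"
proof -
  let ?V = "verts (gr hs)" and ?p = "rho \<delta> (gr hs)" and ?f = "\<lambda>v. z ^ depth new hs v"
  let ?L = "{ns. set ns \<subseteq> ?V \<and> length ns = x}"
  let ?W = "depth_weight \<delta> z G0 new hs" and ?S = "total_weight \<delta> (gr hs)"
  have p1: "(\<Sum>v\<in>?V. ?p v) = 1"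
    using total_weight_pos[of hs] by (simp add: rho_def total_weight_def flip: sum_divide_distrib)
  have pf: "(\<Sum>v\<in>?V. ?p v * ?f v) = ?W / ?S"
    by (simp add: rho_def depth_weight_def total_weight_def sum_divide_distrib)
  have "(\<Sum>ns\<in>?L. prod_list (map ?p ns) * depth_weight \<delta> z G0 new (ns # hs))
    = (\<Sum>ns\<in>?L. ?W * prod_list (map ?p ns) + prod_list (map ?p ns) * sum_list (map ?f ns)
        + (real x + \<delta>) * z * (prod_list (map ?p ns) * ?f (hd ns)))"
    by (intro sum.cong refl) (auto simp: depth_weight_Cons[OF assms(1)] algebra_simps)
  also have "\<dots> = ?W + real x * (?W / ?S) + (real x + \<delta>) * z * (?W / ?S)"
    using sum_lists_prod[OF finite_verts_gr p1, where x = x]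
      sum_lists_prod_hd[OF finite_verts_gr p1 assms(2), where f = ?f]
      sum_lists_prod_sum_list[OF finite_verts_gr p1, where x = x and f = ?f]
    by (simp add: sum.distrib pf flip: sum_distrib_left)
  finally show ?thesis by (simp add: algebra_simps add_divide_distrib)
qed

text \<open>For finite \<open>A\<close> this is the expectation of the depth weight restricted to
  the event that all degrees so far lie in \<open>A\<close>, without normalising by its
  probability.\<close>

definition mean_weight :: "real \<Rightarrow> nat set \<Rightarrow> nat \<Rightarrow> real" where
  "mean_weight z A t =
    (\<Sum>hs\<in>hists G0 new A t. prob (hist_event hs) * depth_weight \<delta> z G0 new hs)"

text \<open>The growth factor for degree \<open>x\<close> is bounded uniformly in \<open>x\<close>
  by taking \<open>x \<le> u\<close> in the numerator and the lower bound on the total weight in the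
  denominator. Continuations are then summed over the disjoint events \<open>E x\<close>.\<close>

lemma mean_weight_Suc:
  assumes "l \<ge> 1" "z \<ge> 0"
  shows "mean_weight z {l..u} (Suc t) \<le> mean_weight z {l..u} t
    * (1 + (real u + (real u + \<delta>) * z) / (total_weight \<delta> G0 + real t * (2 * real l + \<delta>)))"
proof -
  let ?H = "hists G0 new {l..u}" and ?W = "depth_weight \<delta> z G0 new"
  let ?q = "(real u + (real u + \<delta>) * z) / (total_weight \<delta> G0 + real t * (2 * real l + \<delta>))"
  have step: "(\<Sum>ns | set ns \<subseteq> verts (gr hs) \<and> length ns \<in> {l..u}.
      prob (hist_event (ns # hs)) * ?W (ns # hs)) \<le> prob (hist_event hs) * ?W hs * (1 + ?q)"
    if hs: "hs \<in> ?H t" for hs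
  proof -
    let ?L = "\<lambda>x. {ns. set ns \<subseteq> verts (gr hs) \<and> length ns = x}"
    define E where "E x = hist_event hs \<inter> {\<omega> \<in> space M. X (Suc (length hs)) \<omega> = x}" for x
    have E: "E x \<in> events" for x
      using X_measurable[of "Suc (length hs)" "{x}"] hist_event_measurable
      by (auto simp: E_def intro: sets.Int)
    have L: "{ns. set ns \<subseteq> verts (gr hs) \<and> length ns \<in> {l..u}} = (\<Union>x\<in>{l..u}. ?L x)" by auto
    have "(\<Sum>ns | set ns \<subseteq> verts (gr hs) \<and> length ns \<in> {l..u}.
        prob (hist_event (ns # hs)) * ?W (ns # hs))
      = (\<Sum>x\<in>{l..u}. \<Sum>ns\<in>?L x. prob (hist_event (ns # hs)) * ?W (ns # hs))"
      unfolding L by (intro sum.UNION_disjoint)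
        (auto intro: finite_lists_length_eq finite_verts_gr)
    also have "\<dots> = (\<Sum>x\<in>{l..u}. prob (E x) *
        (\<Sum>ns\<in>?L x. prod_list (map (rho \<delta> (gr hs)) ns) * ?W (ns # hs)))"
      unfolding sum_distrib_left
      by (intro sum.cong refl) (auto simp: prob_hist_event_Cons E_def)
    also have "\<dots> \<le> (\<Sum>x\<in>{l..u}. prob (E x) * (?W hs * (1 + ?q)))"
    proof (intro sum_mono mult_left_mono)
      fix x assume x: "x \<in> {l..u}"
      have "(real x + (real x + \<delta>) * z) / total_weight \<delta> (gr hs) \<le> ?q"
        using x assms \<delta>_pos total_weight_G0_pos total_weight_lower[OF hs]
        by (intro frac_le add_mono mult_right_mono) (auto intro!: add_pos_nonneg)
      then show "(\<Sum>ns\<in>?L x. prod_list (map (rho \<delta> (gr hs)) ns) * ?W (ns # hs))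
          \<le> ?W hs * (1 + ?q)"
        using x assms depth_weight_nonneg[of z hs]
        by (simp only: sum_depth_weight_Cons[OF hists_props(2)[OF hs]] atLeastAtMost_iff)
          (auto intro!: mult_left_mono simp: sum_depth_weight_Cons[OF hists_props(2)[OF hs]])
    qed simp
    also have "\<dots> = prob (\<Union>x\<in>{l..u}. E x) * (?W hs * (1 + ?q))"
    proof -
      have "prob (\<Union>x\<in>{l..u}. E x) = (\<Sum>x\<in>{l..u}. prob (E x))"
        using E by (intro finite_measure_finite_Union) (auto simp: disjoint_family_on_def E_def)
      then show ?thesis by (simp add: sum_distrib_right)
    qed
    \<comment> \<open>The part of \<open>hist_event hs\<close> whose next degree leaves
      \<open>{l..u}\<close> is missing on the left, hence only an inequality.\<close>
    also have "\<dots> \<le> prob (hist_event hs) * (?W hs * (1 + ?q))"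
      using depth_weight_nonneg[of z hs] assms \<delta>_pos total_weight_G0_pos
      by (intro mult_right_mono finite_measure_mono hist_event_measurable)
        (auto simp: E_def intro!: mult_nonneg_nonneg add_nonneg_nonneg divide_nonneg_nonneg)
    finally show ?thesis by (simp add: mult_ac)
  qed
  have "mean_weight z {l..u} (Suc t) = (\<Sum>hs\<in>?H t.
      \<Sum>ns | set ns \<subseteq> verts (gr hs) \<and> length ns \<in> {l..u}. prob (hist_event (ns # hs)) * ?W (ns # hs))"
    unfolding mean_weight_def
    by (simp only: hists.simps, subst sum.reindex)
      (auto simp: inj_on_def case_prod_beta sum.Sigma finite_hists finite_lists_in[of _ "{l..u}", simplified] finite_verts_gr)
  also have "\<dots> \<le> (\<Sum>hs\<in>?H t. prob (hist_event hs) * ?W hs * (1 + ?q))"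
    by (intro sum_mono step)
  also have "\<dots> = mean_weight z {l..u} t * (1 + ?q)"
    by (simp add: mean_weight_def sum_distrib_right)
  finally show ?thesis .
qed

lemma mean_weight_nonneg: "z \<ge> 0 \<Longrightarrow> mean_weight z A t \<ge> 0"
  by (auto simp: mean_weight_def depth_weight_nonneg intro!: sum_nonneg)

text \<open>Iterate the one-step bound with \<open>1 + q \<le> exp q\<close>. At time 0 all depths
  are 0, so the start value is the total weight of \<open>G0\<close>.\<close>

lemma mean_weight_le:
  assumes "l \<ge> 1" "z \<ge> 0"
  shows "mean_weight z {l..u} n \<le> total_weight \<delta> G0 *
    exp (\<Sum>t<n. (real u + (real u + \<delta>) * z) / (total_weight \<delta> G0 + real t * (2 * real l + \<delta>)))"
proof (induction n)
  case 0
  show ?case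
    by (simp add: mean_weight_def depth_weight_def total_weight_def hist_event_def prob_space)
next
  case (Suc n)
  let ?q = "\<lambda>t. (real u + (real u + \<delta>) * z) / (total_weight \<delta> G0 + real t * (2 * real l + \<delta>))"
  have "mean_weight z {l..u} (Suc n) \<le> mean_weight z {l..u} n * (1 + ?q n)"
    by (rule mean_weight_Suc[OF assms])
  also have "\<dots> \<le> mean_weight z {l..u} n * exp (?q n)"
    using assms by (intro mult_left_mono mean_weight_nonneg exp_ge_add_one_self)
  also have "\<dots> \<le> total_weight \<delta> G0 * exp (\<Sum>t<n. ?q t) * exp (?q n)"
    using Suc by (intro mult_right_mono) auto
  finally show ?case by (simp add: exp_add mult_ac)
qed

text \<open>Markov's inequality: one vertex of depth above \<open>K\<close> already has weight at
  least \<open>\<delta> * z powr K\<close>, because its factor \<open>deg + \<delta>\<close> is at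
  least \<open>\<delta>\<close>.\<close>

lemma prob_deep_le:
  assumes "finite A" "z > 1"
  shows "prob (\<Union>hs\<in>{hs\<in>hists G0 new A n. \<exists>v\<in>verts (gr hs). real (depth new hs v) > K}. hist_event hs)
    \<le> mean_weight z A n / (\<delta> * z powr K)"
proof -
  let ?B = "{hs\<in>hists G0 new A n. \<exists>v\<in>verts (gr hs). real (depth new hs v) > K}"
  have fin: "finite ?B" using finite_hists[OF assms(1)] by simp
  have big: "\<delta> * z powr K \<le> depth_weight \<delta> z G0 new hs" if hs: "hs \<in> ?B" for hs
  proof -
    obtain v where v: "v \<in> verts (gr hs)" "real (depth new hs v) > K" using hs by auto
    have "\<delta> * z powr K \<le> (real (deg (gr hs) v) + \<delta>) * z ^ depth new hs v"
    proof (intro mult_mono)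
      show "z powr K \<le> z ^ depth new hs v"
        using v(2) assms(2) by (simp add: powr_mono flip: powr_realpow)
    qed (use \<delta>_pos in auto)
    also have "\<dots> \<le> depth_weight \<delta> z G0 new hs"
      unfolding depth_weight_def using v(1) finite_verts_gr \<delta>_pos assms(2)
      by (intro member_le_sum) auto
    finally show ?thesis .
  qed
  have pos: "\<delta> * z powr K > 0" using \<delta>_pos assms(2) by simp
  have "prob (\<Union>hs\<in>?B. hist_event hs) \<le> (\<Sum>hs\<in>?B. prob (hist_event hs))"
    using fin hist_event_measurable by (intro finite_measure_subadditive_finite) auto
  also have "\<dots> \<le> (\<Sum>hs\<in>?B. prob (hist_event hs) * depth_weight \<delta> z G0 new hs / (\<delta> * z powr K))"
  proof (intro sum_mono)
    fix hs assume "hs \<in> ?B"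
    then have "prob (hist_event hs) * (\<delta> * z powr K) \<le> prob (hist_event hs) * depth_weight \<delta> z G0 new hs"
      by (intro mult_left_mono big) auto
    then show "prob (hist_event hs) \<le> prob (hist_event hs) * depth_weight \<delta> z G0 new hs / (\<delta> * z powr K)"
      using pos by (simp only: pos_le_divide_eq)
  qed
  also have "\<dots> \<le> (\<Sum>hs\<in>hists G0 new A n. prob (hist_event hs) * depth_weight \<delta> z G0 new hs / (\<delta> * z powr K))"
    using finite_hists[OF assms(1)] pos depth_weight_nonneg assms(2)
    by (intro sum_mono2) (auto intro!: divide_nonneg_nonneg mult_nonneg_nonneg)
  finally show ?thesis by (simp add: mean_weight_def sum_divide_distrib)
qed

end

end

section \<open>Harmonic sums and the choice of constants\<close>

lemma sum_inverse_shift_le: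
  fixes s c :: real
  assumes "s > 0" "c > 0" "n \<ge> 1"
  shows "(\<Sum>t<n. 1 / (s + real t * c)) \<le> 1 / s + (1 + ln (real n)) / c"
proof -
  \<comment> \<open>With the extra term \<open>t = n\<close> the sum consists of
    \<open>1 / s\<close> and terms \<open>t = 1, ..., n\<close>, each at most
    \<open>1 / (t * c)\<close>; the induction then starts at \<open>ln 1 = 0\<close>. The extra term
    is dropped at the end.\<close>
  have "(\<Sum>t<Suc n. 1 / (s + real t * c)) \<le> 1 / s + (1 + ln (real n)) / c"
    using assms(3)
  proof (induction n rule: nat_induct_at_least)
    case base
    have "1 / (s + c) \<le> 1 / c" using assms by (intro frac_le) auto
    then show ?case by simp
  next
    case (Suc n)
    have n: "real n > 0" using Suc by simp
    have "ln (real n / (real n + 1)) \<le> real n / (real n + 1) - 1"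
      using n by (intro ln_le_minus_one) auto
    also have "\<dots> = - 1 / (real n + 1)" using n by (simp add: field_simps)
    finally have ln: "ln (real n) + 1 / (real n + 1) \<le> ln (real n + 1)"
      using n by (simp add: ln_div)
    have "1 / (s + real (Suc n) * c) \<le> (1 / (real n + 1)) / c"
      using assms n by (simp only: divide_divide_eq_left, intro frac_le)
        (auto simp: algebra_simps intro!: add_pos_pos)
    also have "\<dots> \<le> (ln (real n + 1) - ln (real n)) / c"
      using ln assms by (intro divide_right_mono) auto
    finally have "(\<Sum>t<Suc (Suc n). 1 / (s + real t * c))
        \<le> 1 / s + (1 + ln (real n)) / c + (ln (real n + 1) - ln (real n)) / c"
      using Suc.IH by simp
    also have "\<dots> = 1 / s + (1 + ln (real (Suc n))) / c"
      by (simp add: add_divide_distrib diff_divide_distrib add.commute)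
    finally show ?case .
  qed
  moreover have "0 \<le> 1 / (s + real n * c)" using assms by simp
  ultimately show ?thesis unfolding sum.lessThan_Suc by linarith
qed

text \<open>
  The constant \<open>2 * ((1 + exp 1 + exp 1 * \<delta>) * (1 / s + 1) + d)\<close> absorbs the first summand, the
  lower order term of the harmonic sum and the diameter \<open>d\<close> of the initial graph.
\<close>
lemma exponent_bound:
  fixes s \<delta> d :: real and l u n :: nat
  defines "C \<equiv> 2 * ((1 + exp 1 + exp 1 * \<delta>) * (1 / s + 1) + d)"
  assumes "s > 0" "\<delta> > 0" "d \<ge> 0" "1 \<le> l" "l \<le> u" "n \<ge> 1"
  shows "(\<Sum>t<n. (real u + (real u + \<delta>) * exp 1) / (s + real t * (2 * real l + \<delta>)))
    - (4 * exp 1 * (real u / real l + \<delta> / (2 * real l)) * ln (real n) + C * real u - d) / 2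
    \<le> - ln (real n)"
proof -
  define a where "a = real u + (real u + \<delta>) * exp 1"
  define L where "L = ln (real n)"
  define e where "e = (exp 1 :: real)"
  have e: "e \<ge> 2" using exp_ge_add_one_self[of 1] by (simp add: e_def)
  have L: "L \<ge> 0" using assms by (simp add: L_def)
  have u: "real u \<ge> 1" and l: "real l \<ge> 1" "real l > 0" using assms by auto
  have a: "a \<ge> 0" using assms by (simp add: a_def)
  have a_le: "a \<le> (1 + e + e * \<delta>) * real u"
  proof -
    have "\<delta> * e * 1 \<le> \<delta> * e * real u" using u e assms by (intro mult_left_mono) auto
    then show ?thesis by (simp add: a_def e_def algebra_simps)
  qed
  have "(\<Sum>t<n. a / (s + real t * (2 * real l + \<delta>)))
      = a * (\<Sum>t<n. 1 / (s + real t * (2 * real l + \<delta>)))"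
    by (simp add: sum_distrib_left)
  also have "\<dots> \<le> a * (1 / s + (1 + L) / (2 * real l + \<delta>))"
    unfolding L_def using assms a by (intro mult_left_mono sum_inverse_shift_le) auto
  also have "\<dots> \<le> a * (1 / s + (1 + L / (2 * real l)))"
  proof -
    have "(1 + L) / (2 * real l + \<delta>) = 1 / (2 * real l + \<delta>) + L / (2 * real l + \<delta>)"
      by (simp add: add_divide_distrib)
    \<comment> \<open>The constant part uses \<open>2 * l + \<delta> \<ge> 1\<close>, the
      logarithmic part \<open>2 * l + \<delta> \<ge> 2 * l\<close>.\<close>
    also have "\<dots> \<le> 1 + L / (2 * real l)"
      using L l assms by (intro add_mono divide_left_mono) auto
    finally show ?thesis using a by (intro mult_left_mono add_left_mono) auto
  qed
  also have "\<dots> = a * (1 / s + 1) + a / (2 * real l) * L" by (simp add: algebra_simps)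
  also have "a * (1 / s + 1) \<le> (1 + e + e * \<delta>) * real u * (1 / s + 1)"
    using a_le assms by (intro mult_right_mono) auto
  finally have sum: "(\<Sum>t<n. a / (s + real t * (2 * real l + \<delta>)))
      \<le> (1 + e + e * \<delta>) * real u * (1 / s + 1) + a / (2 * real l) * L" by simp
  \<comment> \<open>The decisive slack: the right side equals
    \<open>3 * e * u - u + e * \<delta>\<close>, which is at least \<open>5 * u\<close> by
    \<open>e \<ge> 2\<close>. Divided by \<open>2 * l\<close>, it says that the depth threshold
    outgrows the exponent of the mean weight by at least \<open>ln n\<close>.\<close>
  have "2 * real l \<le> 4 * e * real u + 2 * e * \<delta> - a"
  proof -
    have "2 * real u \<le> e * real u" using e u by (intro mult_right_mono) auto
    moreover have "e * \<delta> \<ge> 0" using e assms by simp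
    moreover have "real l \<le> real u" using assms by simp
    moreover have "a = real u + e * real u + e * \<delta>"
      by (simp add: a_def e_def algebra_simps)
    moreover have "4 * e * real u = 4 * (e * real u)" "2 * e * \<delta> = 2 * (e * \<delta>)" by simp_all
    ultimately show ?thesis using u by linarith
  qed
  then have "1 \<le> (4 * e * real u + 2 * e * \<delta> - a) / (2 * real l)"
    using l by (simp add: field_simps)
  also have "\<dots> = 2 * e * (real u / real l + \<delta> / (2 * real l)) - a / (2 * real l)"
    using l by (simp add: field_simps)
  finally have "1 * L \<le> (2 * e * (real u / real l + \<delta> / (2 * real l)) - a / (2 * real l)) * L"
    using L by (intro mult_right_mono)
  then have main: "a / (2 * real l) * L - 2 * e * (real u / real l + \<delta> / (2 * real l)) * L \<le> - L"
    by (simp add: algebra_simps)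
  \<comment> \<open>As \<open>u \<ge> 1\<close>, the summand \<open>d\<close> in \<open>C\<close>
    pays for the walk inside the initial graph.\<close>
  have "d * 1 \<le> d * real u" using u assms by (intro mult_left_mono) auto
  then have "d / 2 - d * real u \<le> 0" using assms by linarith
  moreover have "(4 * e * (real u / real l + \<delta> / (2 * real l)) * L + C * real u - d) / 2
      = 2 * e * (real u / real l + \<delta> / (2 * real l)) * L
        + (1 + e + e * \<delta>) * real u * (1 / s + 1) + d * real u - d / 2"
  proof -
    have "(4 * e * Q * L + 2 * (B * B' + d) * real u - d) / 2
        = 2 * e * Q * L + B * real u * B' + d * real u - d / 2" for Q B B'
      by (simp add: algebra_simps add_divide_distrib diff_divide_distrib)
    then show ?thesis unfolding C_def e_def .
  qed
  ultimately have "(\<Sum>t<n. a / (s + real t * (2 * real l + \<delta>)))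
      - (4 * e * (real u / real l + \<delta> / (2 * real l)) * L + C * real u - d) / 2 \<le> - L"
    using sum main by linarith
  then show ?thesis unfolding a_def L_def e_def .
qed

section \<open>Union bound over the two bad events, and the limit\<close>

theorem theorem3p4:
  fixes M :: "'a measure"
    and \<delta> :: real
    and G0 :: "'v mgraph"
    and new :: "nat \<Rightarrow> 'v"
    and X :: "nat \<Rightarrow> 'a \<Rightarrow> nat"
    and N :: "nat \<Rightarrow> 'a \<Rightarrow> 'v list"
    and G :: "nat \<Rightarrow> 'a \<Rightarrow> 'v mgraph"
    and l u :: "nat \<Rightarrow> nat"
  assumes "\<delta> > 0" and "\<delta> \<in> \<rat>"
    and "parid M \<delta> G0 new X N G"
    and "\<And>t \<omega>. t \<ge> 1 \<Longrightarrow> \<omega> \<in> space M \<Longrightarrow> X t \<omega> \<ge> 1"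
    and "prob_space.indep_vars M (\<lambda>_. count_space UNIV) X {1..}"
    and "\<And>t. t \<ge> 1 \<Longrightarrow> distr M (count_space UNIV) (X t) = distr M (count_space UNIV) (X 1)"
    and "\<And>n. n \<ge> 1 \<Longrightarrow> l n \<ge> 1" and "\<And>n. n \<ge> 1 \<Longrightarrow> u n \<ge> 1"
    and "(\<lambda>n. measure M {\<omega> \<in> space M. X 1 \<omega> \<notin> {l n..u n}}) \<in> o(\<lambda>n. 1 / real n)"
  shows "\<exists>C :: real. (\<lambda>n. measure M {\<omega> \<in> space M.
            ereal_of_enat (graph_diameter (G n \<omega>))
            \<le> ereal (4 * exp 1 * (real (u n) / real (l n) + \<delta> / (2 * real (l n))) * ln (real n)
                      + C * real (u n))})
          \<longlonglongrightarrow> 1"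
proof -
  interpret parid M \<delta> G0 new X N G by fact
  obtain D where D: "\<And>x y. x \<in> verts G0 \<Longrightarrow> y \<in> verts G0 \<Longrightarrow> \<exists>k\<le>D. (x, y) \<in> adj G0 ^^ k"
    using connected_bounded_walks[OF G0_wf G0_connected] by metis
  define s where "s = total_weight \<delta> G0"
  have s: "s > 0" unfolding s_def by (rule total_weight_G0_pos[OF assms(1)])
  \<comment> \<open>\<open>C\<close> depends only on \<open>\<delta>\<close> and, through
    \<open>s\<close> and \<open>D\<close>, on \<open>G0\<close>, so it is constant in
    \<open>n\<close>.\<close>
  define C where "C = 2 * ((1 + exp 1 + exp 1 * \<delta>) * (1 / s + 1) + real D)"
  define T where "T n = 4 * exp 1 * (real (u n) / real (l n) + \<delta> / (2 * real (l n))) * ln (real n)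
      + C * real (u n)" for n
  define good where "good n = {\<omega> \<in> space M. ereal_of_enat (graph_diameter (G n \<omega>)) \<le> ereal (T n)}" for n
  define p where "p n = prob {\<omega> \<in> space M. X 1 \<omega> \<notin> {l n..u n}}" for n
  have good_meas: "good n \<in> events" for n
  proof -
    have "good n = {\<omega> \<in> space M. ereal_of_enat (graph_diameter (gr (hist n \<omega>))) \<le> ereal (T n)}"
      by (auto simp: good_def G_eq_gr)
    then show ?thesis using hist_pred_measurable by simp
  qed
  have X_out: "prob {\<omega> \<in> space M. X t \<omega> \<notin> {l n..u n}} = p n" if t: "t \<ge> 1" for t n
  proof -
    have "X r \<in> M \<rightarrow>\<^sub>M count_space UNIV" if "r \<ge> 1" for r
      using X_measurable[OF that] by (auto simp: measurable_def vimage_def Int_def conj_commute)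
    then have "measure (distr M (count_space UNIV) (X r)) (- {l n..u n})
        = prob {\<omega> \<in> space M. X r \<omega> \<notin> {l n..u n}}" if "r \<ge> 1" for r
      using that by (subst measure_distr) (auto intro!: arg_cong[of _ _ prob])
    from this[OF t] this[of 1] show ?thesis using assms(6)[OF t] by (simp add: p_def)
  qed
  \<comment> \<open>The first summand bounds the probability that one of the first \<open>n\<close>
    degrees leaves the range, the second the probability of a vertex deeper than
    \<open>K\<close>.\<close>
  have bound: "1 - prob (good n) \<le> real n * p n + s / \<delta> * (1 / real n)"
    if n: "n \<ge> 1" and lu: "l n \<le> u n" for n
  proof -
    let ?A = "{l n..u n}"
    \<comment> \<open>Chosen so that two descents of length \<open>K\<close> and a walk of length
      \<open>D\<close> add up to \<open>T n\<close>.\<close>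
    define K where "K = (T n - real D) / 2"
    have TK: "2 * K + real D = T n" by (simp add: K_def diff_divide_distrib)
    let ?out = "\<Union>t\<in>{1..n}. {\<omega> \<in> space M. X t \<omega> \<notin> ?A}"
    let ?B = "{hs \<in> hists G0 new ?A n. \<exists>v\<in>verts (gr hs). real (depth new hs v) > K}"
    let ?deep = "\<Union>hs\<in>?B. hist_event hs"
    have A: "finite ?A" "0 \<notin> ?A" "l n \<ge> 1" using assms(7)[OF n] by auto
    have out: "?out \<in> events" using X_measurable[of _ "- ?A"] by (intro sets.finite_UN) auto
    have deep: "?deep \<in> events"
      using hist_event_measurable finite_hists[OF A(1)] by (intro sets.finite_UN) auto
    have sub: "space M - good n \<subseteq> ?out \<union> ?deep"
    proof
      fix \<omega> assume w: "\<omega> \<in> space M - good n"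
      show "\<omega> \<in> ?out \<union> ?deep"
      proof (rule ccontr)
        assume not: "\<omega> \<notin> ?out \<union> ?deep"
        then have h: "hist n \<omega> \<in> hists G0 new ?A n"
          using w by (intro hist_in_hists) auto
        moreover have "\<omega> \<in> hist_event (hist n \<omega>)" using w by (simp add: hist_event_def)
        ultimately have "real (depth new (hist n \<omega>) v) \<le> K" if "v \<in> verts (gr (hist n \<omega>))" for v
          using not that by force
        from diameter_le_depth[OF D h A(2) this]
        have "ereal_of_enat (graph_diameter (gr (hist n \<omega>))) \<le> ereal (T n)"
          by (simp only: TK)
        then have "\<omega> \<in> good n" using w by (simp add: good_def G_eq_gr)
        with w show False by simp
      qed
    qed
    have "prob ?out \<le> (\<Sum>t\<in>{1..n}. prob {\<omega> \<in> space M. X t \<omega> \<notin> ?A})"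
      using X_measurable[of _ "- ?A"] by (intro finite_measure_subadditive_finite) auto
    also have "\<dots> = (\<Sum>t\<in>{1..n}. p n)" by (intro sum.cong refl X_out) simp
    also have "\<dots> = real n * p n" by simp
    finally have out_le: "prob ?out \<le> real n * p n" .
    let ?S = "\<Sum>t<n. (real (u n) + (real (u n) + \<delta>) * exp 1) / (s + real t * (2 * real (l n) + \<delta>))"
    have "prob ?deep \<le> mean_weight (exp 1) ?A n / (\<delta> * exp 1 powr K)"
      by (rule prob_deep_le[OF assms(1) A(1)]) simp
    also have "\<dots> \<le> s * exp ?S / (\<delta> * exp 1 powr K)"
      unfolding s_def using assms(1) A by (intro divide_right_mono mean_weight_le) auto
    also have "\<dots> = s / \<delta> * exp (?S - K)" by (simp add: powr_def exp_diff)
    \<comment> \<open>\<open>exponent_bound\<close> shows that the exponent is at most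
      \<open>- ln n\<close>.\<close>
    also have "\<dots> \<le> s / \<delta> * exp (- ln (real n))"
      using exponent_bound[OF s assms(1) _ A(3) lu n, of "real D"] s assms(1)
      by (intro mult_left_mono) (auto simp: K_def T_def C_def)
    also have "exp (- ln (real n)) = 1 / real n" using n by (simp add: exp_minus field_simps)
    finally have deep_le: "prob ?deep \<le> s / \<delta> * (1 / real n)" .
    have "1 - prob (good n) = prob (space M - good n)" using good_meas by (simp add: prob_compl)
    also have "\<dots> \<le> prob (?out \<union> ?deep)"
      using sub out deep by (intro finite_measure_mono) auto
    also have "\<dots> \<le> prob ?out + prob ?deep" using out deep by (rule measure_Un_le)
    finally show ?thesis using out_le deep_le by simp
  qed
  have "(\<lambda>n. p n / (1 / real n)) \<longlonglongrightarrow> 0"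
    using assms(9) unfolding p_def by (rule smalloD_tendsto)
  then have lim_p: "(\<lambda>n. real n * p n) \<longlonglongrightarrow> 0" by (simp add: mult.commute)
  then have "eventually (\<lambda>n. real n * p n < 1) sequentially" by (rule order_tendstoD) simp
  \<comment> \<open>If \<open>u n < l n\<close>, the interval is empty and \<open>p n = 1\<close>,
    which contradicts \<open>n * p n < 1\<close> for \<open>n \<ge> 1\<close>.\<close>
  then have lu: "eventually (\<lambda>n. l n \<le> u n) sequentially"
    using eventually_ge_at_top[of 1]
  proof eventually_elim
    case (elim n)
    show "l n \<le> u n"
    proof (rule ccontr)
      assume "\<not> l n \<le> u n"
      then have "p n = 1" by (simp add: p_def prob_space)
      with elim show False by simp
    qed
  qed
  have "(\<lambda>n. 1 - prob (good n)) \<longlonglongrightarrow> 0"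
  proof (rule tendsto_sandwich)
    show "eventually (\<lambda>n. 0 \<le> 1 - prob (good n)) sequentially" by simp
    show "eventually (\<lambda>n. 1 - prob (good n) \<le> real n * p n + s / \<delta> * (1 / real n)) sequentially"
      using lu eventually_ge_at_top[of 1] by eventually_elim (rule bound)
    show "(\<lambda>n. real n * p n + s / \<delta> * (1 / real n)) \<longlonglongrightarrow> 0"
      using tendsto_add[OF lim_p tendsto_mult_right_zero[OF lim_1_over_n, of "s / \<delta>"]] by simp
  qed simp
  from tendsto_diff[OF tendsto_const[of 1] this] have "(\<lambda>n. prob (good n)) \<longlonglongrightarrow> 1" by simp
  then show ?thesis unfolding good_def T_def by blast
qed

end
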